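(* Every connected covering of $k$-graphs is isomorphic to a relative skew-product covering. That is, if $p:\Omega\to\Lambda$ is a connected covering, then there exist a group $G$, a cocycle $\eta:\Lambda\to G$ and a subgroup $H$ of $G$ such that $(\Omega,p)$ is isomorphic, as a covering of $\Lambda$, to the relative skew-product covering $\Lambda\times_\eta G/H\to\Lambda$.
   Context: A $k$-graph is a small category $\Lambda$ with a functor $d:\Lambda\to\mathbb N^k$ (the degree) satisfying the factorization property: if $d(\alpha)=n+l$ with $n,l\in\mathbb N^k$, there are unique $\beta,\gamma\in\Lambda$ with $d(\beta)=n$, $d(\gamma)=l$, $\alpha=\beta\gamma$. $\Lambda^0$ is the set of objects (vertices, identified with identity morphisms); $s(\alpha)$ and $r(\alpha)$ are the domain and codomain of $\alpha$. $u\mathcal C=r^{-1}(u)$, $\mathcal C v=s^{-1}(v)$, $u\mathcal Cv=u\mathcal C\cap\mathcal Cv$. A small category $\mathcal C$ is connected if the equivalence relation on $\mathcal C^0$ generated by $\{(u,v)\mid u\mathcal Cv\neq\emptyset\}$ is all of $\mathcal C^0\times\mathcal C^0$. A $k$-graph morphism is a degree-preserving functor. A covering of $\Lambda$ is a surjective $k$-graph morphism $p:\Omega\to\Lambda$ such that for all $v\in\Omega^0$, $p$ maps $\Omega v$ bijectively onto $\Lambda p(v)$ and $v\Omega$ bijectively onto $p(v)\Lambda$. It is connected if $\Omega$ is connected. A morphism of coverings $(\Omega,p)\to(\Sigma,q)$ of $\Lambda$ is a $k$-graph morphism $\phi:\Omega\to\Sigma$ with $q\circ\phi=p$. A cocycle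 on $\Lambda$ is a functor $\eta:\Lambda\to G$ to a group $G$. For a subgroup $H$ of $G$, the relative skew product $\Lambda\times_\eta G/H$ is the set $\Lambda\times G/H$ made into a $k$-graph by $s(\lambda,gH)=(s(\lambda),gH)$, $r(\lambda,gH)=(r(\lambda),\eta(\lambda)gH)$, $(\lambda,\eta(\mu)gH)(\mu,gH)=(\lambda\mu,gH)$, $d(\lambda,gH)=d(\lambda)$; the relative skew-product covering is the coordinate projection $\Lambda\times_\eta G/H\to\Lambda$. *)

theory Defs
  imports "HOL-Algebra.Left_Coset"
begin

text \<open>A small category is given by its set of morphisms, with the objects identified with the
  identity morphisms. \<open>src\<close> is the domain and \<open>rng\<close> the codomain; the composite \<open>f \<cdot> g\<close> is
  meaningful when \<open>src f = rng g\<close>.\<close>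

record 'a category =
  Mor :: "'a set"
  Obj :: "'a set"
  src :: "'a \<Rightarrow> 'a"
  rng :: "'a \<Rightarrow> 'a"
  cmp :: "'a \<Rightarrow> 'a \<Rightarrow> 'a" (infixl "\<cdot>\<index>" 70)

locale small_category =
  fixes C :: "('a, 'm) category_scheme" (structure)
  assumes Obj_subset: "Obj C \<subseteq> Mor C"
    and src_Obj: "f \<in> Mor C \<Longrightarrow> src C f \<in> Obj C"
    and rng_Obj: "f \<in> Mor C \<Longrightarrow> rng C f \<in> Obj C"
    and src_id: "v \<in> Obj C \<Longrightarrow> src C v = v"
    and rng_id: "v \<in> Obj C \<Longrightarrow> rng C v = v"
    and cmp_closed: "\<lbrakk>f \<in> Mor C; g \<in> Mor C; src C f = rng C g\<rbrakk> \<Longrightarrow> f \<cdot> g \<in> Mor C"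
    and src_cmp: "\<lbrakk>f \<in> Mor C; g \<in> Mor C; src C f = rng C g\<rbrakk> \<Longrightarrow> src C (f \<cdot> g) = src C g"
    and rng_cmp: "\<lbrakk>f \<in> Mor C; g \<in> Mor C; src C f = rng C g\<rbrakk> \<Longrightarrow> rng C (f \<cdot> g) = rng C f"
    and cmp_id_right: "f \<in> Mor C \<Longrightarrow> f \<cdot> src C f = f"
    and cmp_id_left: "f \<in> Mor C \<Longrightarrow> rng C f \<cdot> f = f"
    and cmp_assoc: "\<lbrakk>f \<in> Mor C; g \<in> Mor C; h \<in> Mor C; src C f = rng C g; src C g = rng C h\<rbrakk>
      \<Longrightarrow> f \<cdot> g \<cdot> h = f \<cdot> (g \<cdot> h)"

locale category_functor =
  source: small_category C + target: small_category D
  for C :: "('a, 'm) category_scheme" (structure)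
    and D :: "('b, 'n) category_scheme" (structure) +
  fixes F :: "'a \<Rightarrow> 'b"
  assumes map_Mor: "f \<in> Mor C \<Longrightarrow> F f \<in> Mor D"
    and map_Obj: "v \<in> Obj C \<Longrightarrow> F v \<in> Obj D"
    and map_src: "f \<in> Mor C \<Longrightarrow> src D (F f) = F (src C f)"
    and map_rng: "f \<in> Mor C \<Longrightarrow> rng D (F f) = F (rng C f)"
    and map_cmp: "\<lbrakk>f \<in> Mor C; g \<in> Mor C; src C f = rng C g\<rbrakk>
      \<Longrightarrow> F (f \<cdot>\<^bsub>C\<^esub> g) = F f \<cdot>\<^bsub>D\<^esub> F g"

text \<open>\<open>into C u = u C\<close>, \<open>out_of C v = C v\<close> and \<open>hom_set C u v = u C v\<close>.\<close>

definition into :: "('a, 'm) category_scheme \<Rightarrow> 'a \<Rightarrow> 'a set"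
  where "into C u = {f \<in> Mor C. rng C f = u}"

definition out_of :: "('a, 'm) category_scheme \<Rightarrow> 'a \<Rightarrow> 'a set"
  where "out_of C v = {f \<in> Mor C. src C f = v}"

definition hom_set :: "('a, 'm) category_scheme \<Rightarrow> 'a \<Rightarrow> 'a \<Rightarrow> 'a set"
  where "hom_set C u v = into C u \<inter> out_of C v"

definition generated_equiv :: "'a set \<Rightarrow> ('a \<times> 'a) set \<Rightarrow> ('a \<times> 'a) set"
  where "generated_equiv A R = \<Inter>{E. equiv A E \<and> R \<subseteq> E}"

definition connected_category :: "('a, 'm) category_scheme \<Rightarrow> bool"
  where "connected_category C \<longleftrightarrow>
    generated_equiv (Obj C) {(u, v). u \<in> Obj C \<and> v \<in> Obj C \<and> hom_set C u v \<noteq> {}}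
      = Obj C \<times> Obj C"

definition monoid_category :: "('a, 'm) monoid_scheme \<Rightarrow> 'a category"
  where "monoid_category M =
    \<lparr>Mor = carrier M, Obj = {\<one>\<^bsub>M\<^esub>}, src = (\<lambda>_. \<one>\<^bsub>M\<^esub>), rng = (\<lambda>_. \<one>\<^bsub>M\<^esub>), cmp = mult M\<rparr>"

text \<open>The additive monoid of \<open>k\<close>-tuples of naturals, as functions vanishing at all indices
  \<open>i \<ge> k\<close>. (The case \<open>k = 0\<close> is included.)\<close>

definition degree_monoid :: "nat \<Rightarrow> (nat \<Rightarrow> nat) monoid"
  where "degree_monoid k =
    \<lparr>carrier = {n. \<forall>i\<ge>k. n i = 0}, mult = (\<lambda>m n i. m i + n i), one = (\<lambda>_. 0)\<rparr>"

record 'a kgraph = "'a category" +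
  deg :: "'a \<Rightarrow> nat \<Rightarrow> nat"

locale k_graph =
  category_functor \<Lambda> "monoid_category (degree_monoid k)" "deg \<Lambda>"
  for k :: nat and \<Lambda> :: "('a, 'm) kgraph_scheme" (structure) +
  assumes factorization:
    "\<lbrakk>\<alpha> \<in> Mor \<Lambda>; n \<in> carrier (degree_monoid k); l \<in> carrier (degree_monoid k);
      deg \<Lambda> \<alpha> = n \<otimes>\<^bsub>degree_monoid k\<^esub> l\<rbrakk>
     \<Longrightarrow> \<exists>!(\<beta>, \<gamma>). \<beta> \<in> Mor \<Lambda> \<and> \<gamma> \<in> Mor \<Lambda> \<and> src \<Lambda> \<beta> = rng \<Lambda> \<gamma> \<and>
           deg \<Lambda> \<beta> = n \<and> deg \<Lambda> \<gamma> = l \<and> \<alpha> = \<beta> \<cdot> \<gamma>"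

locale k_graph_morphism =
  source: k_graph k \<Omega> + target: k_graph k \<Lambda> + category_functor \<Omega> \<Lambda> \<phi>
  for k :: nat
    and \<Omega> :: "('b, 'm) kgraph_scheme" (structure)
    and \<Lambda> :: "('a, 'n) kgraph_scheme" (structure)
    and \<phi> :: "'b \<Rightarrow> 'a" +
  assumes map_deg: "\<alpha> \<in> Mor \<Omega> \<Longrightarrow> deg \<Lambda> (\<phi> \<alpha>) = deg \<Omega> \<alpha>"

locale covering = k_graph_morphism k \<Omega> \<Lambda> p
  for k :: nat
    and \<Lambda> :: "('a, 'n) kgraph_scheme" (structure)
    and \<Omega> :: "('b, 'm) kgraph_scheme" (structure)
    and p :: "'b \<Rightarrow> 'a" +
  assumes surjective: "p ` Mor \<Omega> = Mor \<Lambda>"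
    and bij_out_of: "v \<in> Obj \<Omega> \<Longrightarrow> bij_betw p (out_of \<Omega> v) (out_of \<Lambda> (p v))"
    and bij_into: "v \<in> Obj \<Omega> \<Longrightarrow> bij_betw p (into \<Omega> v) (into \<Lambda> (p v))"

locale connected_covering = covering k \<Lambda> \<Omega> p
  for k :: nat
    and \<Lambda> :: "('a, 'n) kgraph_scheme" (structure)
    and \<Omega> :: "('b, 'm) kgraph_scheme" (structure)
    and p :: "'b \<Rightarrow> 'a" +
  assumes connected: "connected_category \<Omega>"

locale covering_morphism =
  source_covering: covering k \<Lambda> \<Omega> p + target_covering: covering k \<Lambda> \<Sigma> q +
  k_graph_morphism k \<Omega> \<Sigma> \<phi>
  for k :: nat
    and \<Lambda> :: "('a, 'l) kgraph_scheme" (structure)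
    and \<Omega> :: "('b, 'm) kgraph_scheme" (structure)
    and p :: "'b \<Rightarrow> 'a"
    and \<Sigma> :: "('c, 'n) kgraph_scheme" (structure)
    and q :: "'c \<Rightarrow> 'a"
    and \<phi> :: "'b \<Rightarrow> 'c" +
  assumes over: "\<alpha> \<in> Mor \<Omega> \<Longrightarrow> q (\<phi> \<alpha>) = p \<alpha>"

definition isomorphic_coverings ::
    "nat \<Rightarrow> ('a, 'l) kgraph_scheme \<Rightarrow> ('b, 'm) kgraph_scheme \<Rightarrow> ('b \<Rightarrow> 'a)
      \<Rightarrow> ('c, 'n) kgraph_scheme \<Rightarrow> ('c \<Rightarrow> 'a) \<Rightarrow> bool"
  where "isomorphic_coverings k \<Lambda> \<Omega> p \<Sigma> q \<longleftrightarrow>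
    (\<exists>\<phi> \<psi>. covering_morphism k \<Lambda> \<Omega> p \<Sigma> q \<phi> \<and> covering_morphism k \<Lambda> \<Sigma> q \<Omega> p \<psi> \<and>
      (\<forall>\<alpha>\<in>Mor \<Omega>. \<psi> (\<phi> \<alpha>) = \<alpha>) \<and> (\<forall>\<beta>\<in>Mor \<Sigma>. \<phi> (\<psi> \<beta>) = \<beta>))"

locale cocycle =
  k_graph k \<Lambda> + group G + category_functor \<Lambda> "monoid_category G" \<eta>
  for k :: nat
    and \<Lambda> :: "('a, 'm) kgraph_scheme" (structure)
    and G :: "('g, 'n) monoid_scheme" (structure)
    and \<eta> :: "'a \<Rightarrow> 'g"

text \<open>\<open>G/H\<close> is the set of left cosets \<open>gH\<close>, on which \<open>G\<close> acts by \<open>g \<cdot> X = gX\<close>.\<close>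

definition relative_skew_product ::
    "('a, 'm) kgraph_scheme \<Rightarrow> ('g, 'n) monoid_scheme \<Rightarrow> ('a \<Rightarrow> 'g) \<Rightarrow> 'g set
      \<Rightarrow> ('a \<times> 'g set) kgraph"
  where "relative_skew_product \<Lambda> G \<eta> H =
    \<lparr>Mor = Mor \<Lambda> \<times> (lcosets\<^bsub>G\<^esub> H),
     Obj = Obj \<Lambda> \<times> (lcosets\<^bsub>G\<^esub> H),
     src = (\<lambda>(\<kappa>, X). (src \<Lambda> \<kappa>, X)),
     rng = (\<lambda>(\<kappa>, X). (rng \<Lambda> \<kappa>, \<eta> \<kappa> <#\<^bsub>G\<^esub> X)),
     cmp = (\<lambda>(\<kappa>, X) (\<mu>, Y). (\<kappa> \<cdot>\<^bsub>\<Lambda>\<^esub> \<mu>, Y)),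
     deg = (\<lambda>(\<kappa>, X). deg \<Lambda> \<kappa>)\<rparr>"

end

theory Submission
  imports Defs "HOL-Algebra.Bij" "HOL-Library.Equipollence"
begin

text \<open>In a covering \<open>p : \<Omega> \<rightarrow> \<Lambda>\<close> each \<open>\<kappa> \<in> \<Lambda>\<close> transports the fibre over \<open>s(\<kappa>)\<close> bijectively
  onto the fibre over \<open>r(\<kappa>)\<close>. If \<open>\<Omega>\<close> is connected, all fibres therefore have the cardinality of
  one set \<open>F\<close>; identify every fibre with \<open>F\<close> by arbitrary bijections. The transport becomes a
  cocycle \<open>\<eta>\<close> with values in the full symmetric group of \<open>F\<close>. This group is transitive, so \<open>F\<close>
  is \<open>G/H\<close> for the stabiliser \<open>H\<close> of a point, and a morphism of \<open>\<Omega>\<close> is determined by its image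
  in \<open>\<Lambda>\<close> together with the element of \<open>F\<close> that labels its source. No fundamental group is
  needed, since \<open>G\<close> may be larger than the group generated by the values of \<open>\<eta>\<close>.\<close>

section \<open>Relative skew products\<close>

lemma relative_skew_product_simps [simp]:
  "Mor (relative_skew_product \<Lambda> G \<eta> H) = Mor \<Lambda> \<times> (lcosets\<^bsub>G\<^esub> H)"
  "Obj (relative_skew_product \<Lambda> G \<eta> H) = Obj \<Lambda> \<times> (lcosets\<^bsub>G\<^esub> H)"
  "src (relative_skew_product \<Lambda> G \<eta> H) (\<kappa>, X) = (src \<Lambda> \<kappa>, X)"
  "rng (relative_skew_product \<Lambda> G \<eta> H) (\<kappa>, X) = (rng \<Lambda> \<kappa>, \<eta> \<kappa> <#\<^bsub>G\<^esub> X)"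
  "(\<kappa>, X) \<cdot>\<^bsub>relative_skew_product \<Lambda> G \<eta> H\<^esub> (\<mu>, Y) = (\<kappa> \<cdot>\<^bsub>\<Lambda>\<^esub> \<mu>, Y)"
  "deg (relative_skew_product \<Lambda> G \<eta> H) (\<kappa>, X) = deg \<Lambda> \<kappa>"
  by (simp_all add: relative_skew_product_def)

lemma monoid_category_simps [simp]:
  "Mor (monoid_category M) = carrier M"
  "Obj (monoid_category M) = {\<one>\<^bsub>M\<^esub>}"
  "src (monoid_category M) x = \<one>\<^bsub>M\<^esub>"
  "rng (monoid_category M) x = \<one>\<^bsub>M\<^esub>"
  "x \<cdot>\<^bsub>monoid_category M\<^esub> y = x \<otimes>\<^bsub>M\<^esub> y"
  by (simp_all add: monoid_category_def)

lemma (in monoid) small_category_monoid_category: "small_category (monoid_category G)"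
  by unfold_locales (auto simp: m_assoc)

context group
begin

lemma lcosets_subset_carrier: "\<lbrakk>subgroup H G; X \<in> lcosets H\<rbrakk> \<Longrightarrow> X \<subseteq> carrier G"
  by (auto simp: LCOSETS_def l_coset_def dest: subgroup.mem_carrier)

lemma l_coset_lcosets:
  assumes "subgroup H G" "X \<in> lcosets H" "g \<in> carrier G"
  shows "g <# X \<in> lcosets H"
  using assms lcos_m_assoc[OF subgroup.subset[OF assms(1)]]
  by (auto simp: LCOSETS_def)

lemma l_coset_inv_cancel:
  assumes "X \<subseteq> carrier G" "g \<in> carrier G"
  shows "inv g <# (g <# X) = X" "g <# (inv g <# X) = X"
  using assms by (simp_all add: lcos_m_assoc lcos_mult_one)

lemma lcosets_nonempty: "lcosets H \<noteq> {}"
  by (auto simp: LCOSETS_def)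

end

context cocycle
begin

lemma eta_closed: "f \<in> Mor \<Lambda> \<Longrightarrow> \<eta> f \<in> carrier G"
  using map_Mor by simp

lemma eta_Obj: "v \<in> Obj \<Lambda> \<Longrightarrow> \<eta> v = \<one>\<^bsub>G\<^esub>"
  using map_Obj by simp

lemma eta_cmp:
  "\<lbrakk>f \<in> Mor \<Lambda>; g \<in> Mor \<Lambda>; src \<Lambda> f = rng \<Lambda> g\<rbrakk>
    \<Longrightarrow> \<eta> (f \<cdot>\<^bsub>\<Lambda>\<^esub> g) = \<eta> f \<otimes>\<^bsub>G\<^esub> \<eta> g"
  using map_cmp by simp

text \<open>The category laws are those of \<open>\<Lambda>\<close> combined with the action of
  \<open>G\<close> on cosets: \<open>\<eta>\<close> of a vertex fixes every coset, and
  \<open>\<eta>\<close> of a composite acts as its two values in turn. Factorizations are inherited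
  from \<open>\<Lambda>\<close> because the cosets of both factors are forced.\<close>

lemma k_graph_relative_skew_product:
  assumes H: "subgroup H G"
  shows "k_graph k (relative_skew_product \<Lambda> G \<eta> H)"
proof -
  let ?S = "relative_skew_product \<Lambda> G \<eta> H"
  have d: "category_functor \<Lambda> (monoid_category (degree_monoid k)) (deg \<Lambda>)" by unfold_locales
  note sub = lcosets_subset_carrier[OF H]
  note cl = l_coset_lcosets[OF H]
  interpret small_category ?S
  proof unfold_locales
    show "Obj ?S \<subseteq> Mor ?S" using source.Obj_subset by auto
  qed (auto simp: source.src_Obj source.rng_Obj source.src_id source.rng_id source.cmp_closed
      source.src_cmp source.rng_cmp source.cmp_id_right source.cmp_id_left source.cmp_assoc eta_closed eta_Obj eta_cmp
      lcos_mult_one lcos_m_assoc sub cl)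
  interpret category_functor ?S "monoid_category (degree_monoid k)" "deg ?S"
    by unfold_locales (use category_functor.map_Mor[OF d] category_functor.map_Obj[OF d]
        category_functor.map_src[OF d] category_functor.map_rng[OF d]
        category_functor.map_cmp[OF d] in auto)
  show ?thesis
  proof unfold_locales
    fix \<alpha> n l
    assume "\<alpha> \<in> Mor ?S" and nl: "n \<in> carrier (degree_monoid k)" "l \<in> carrier (degree_monoid k)"
      and "deg ?S \<alpha> = n \<otimes>\<^bsub>degree_monoid k\<^esub> l"
    then obtain \<kappa> X where \<alpha>: "\<alpha> = (\<kappa>, X)" "\<kappa> \<in> Mor \<Lambda>" "X \<in> lcosets\<^bsub>G\<^esub> H"
      and deg: "deg \<Lambda> \<kappa> = n \<otimes>\<^bsub>degree_monoid k\<^esub> l" by auto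
    let ?P = "\<lambda>\<beta> \<gamma>. \<beta> \<in> Mor \<Lambda> \<and> \<gamma> \<in> Mor \<Lambda> \<and> src \<Lambda> \<beta> = rng \<Lambda> \<gamma> \<and>
           deg \<Lambda> \<beta> = n \<and> deg \<Lambda> \<gamma> = l \<and> \<kappa> = \<beta> \<cdot>\<^bsub>\<Lambda>\<^esub> \<gamma>"
    from factorization[OF \<alpha>(2) nl deg] obtain \<beta> \<gamma>
      where P: "?P \<beta> \<gamma>" and uniq: "\<And>\<beta>' \<gamma>'. ?P \<beta>' \<gamma>' \<Longrightarrow> \<beta>' = \<beta> \<and> \<gamma>' = \<gamma>"
      by (auto simp: Ex1_def)
    show "\<exists>!(\<beta>, \<gamma>). \<beta> \<in> Mor ?S \<and> \<gamma> \<in> Mor ?S \<and> src ?S \<beta> = rng ?S \<gamma> \<and>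
           deg ?S \<beta> = n \<and> deg ?S \<gamma> = l \<and> \<alpha> = \<beta> \<cdot>\<^bsub>?S\<^esub> \<gamma>"
    \<comment> \<open>A composite carries the coset of its right factor, so \<open>\<gamma>\<close>
      must carry \<open>X\<close>; composability then forces the coset of \<open>\<beta>\<close> to
      be the one in the range of \<open>(\<gamma>, X)\<close>.\<close>
    proof (rule ex1I[of _ "((\<beta>, \<eta> \<gamma> <#\<^bsub>G\<^esub> X), (\<gamma>, X))"], goal_cases)
      case 1
      show ?case using P \<alpha> by (auto simp: cl eta_closed)
    next
      case (2 z)
      then obtain a b where z: "z = ((a, \<eta> b <#\<^bsub>G\<^esub> X), (b, X))" and "?P a b"
        using \<alpha> by (cases z) auto
      then show ?case using uniq[of a b] by simp
    qed
  qed
qed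

lemma covering_relative_skew_product:
  assumes H: "subgroup H G"
  shows "covering k \<Lambda> (relative_skew_product \<Lambda> G \<eta> H) fst"
proof -
  let ?S = "relative_skew_product \<Lambda> G \<eta> H"
  interpret S: k_graph k ?S by (rule k_graph_relative_skew_product[OF H])
  note sub = lcosets_subset_carrier[OF H]
  note cl = l_coset_lcosets[OF H]
  show ?thesis
  proof unfold_locales
    show "fst ` Mor ?S = Mor \<Lambda>"
      using lcosets_nonempty by simp
  next
    fix v assume "v \<in> Obj ?S"
    then show "bij_betw fst (out_of ?S v) (out_of \<Lambda> (fst v))"
      by (intro bij_betw_byWitness[where f' = "\<lambda>\<kappa>. (\<kappa>, snd v)"]) (auto simp: out_of_def)
  next
    fix v assume "v \<in> Obj ?S"
    \<comment> \<open>A prescribed range fixes \<open>\<eta> \<kappa> <# X\<close>, so the coset is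
      recovered by translating back with the inverse of \<open>\<eta> \<kappa>\<close>. For a
      prescribed source the coset was given outright.\<close>
    then show "bij_betw fst (into ?S v) (into \<Lambda> (fst v))"
      by (intro bij_betw_byWitness[where f' = "\<lambda>\<kappa>. (\<kappa>, inv\<^bsub>G\<^esub> (\<eta> \<kappa>) <#\<^bsub>G\<^esub> snd v)"])
        (auto simp: into_def l_coset_inv_cancel eta_closed sub cl)
  qed auto
qed

end

section \<open>Bijective morphisms of coverings\<close>

text \<open>Every identity required of the inverse holds after applying \<open>\<phi>\<close>, and
  injectivity removes \<open>\<phi>\<close> again. Bijectivity is assumed on morphisms only, so
  objects need an argument of their own.\<close>

lemma (in covering_morphism) isomorphic_coverings_if_bij:
  assumes bij: "bij_betw \<phi> (Mor \<Omega>) (Mor \<Sigma>)"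
  shows "isomorphic_coverings k \<Lambda> \<Omega> p \<Sigma> q"
proof -
  define \<psi> where "\<psi> = inv_into (Mor \<Omega>) \<phi>"
  have \<psi>\<phi>: "\<psi> (\<phi> f) = f" if "f \<in> Mor \<Omega>" for f
    using that bij by (simp add: \<psi>_def bij_betw_inv_into_left)
  have ex: "\<exists>f\<in>Mor \<Omega>. b = \<phi> f" if "b \<in> Mor \<Sigma>" for b
    using that bij by (auto simp: bij_betw_def image_iff)
  have src_Mor: "src \<Omega> f \<in> Mor \<Omega>" and rng_Mor: "rng \<Omega> f \<in> Mor \<Omega>" if "f \<in> Mor \<Omega>" for f
    using that source_covering.source.source.src_Obj source_covering.source.source.rng_Obj
      source_covering.source.source.Obj_subset by auto
  have \<psi>_Obj: "\<psi> v \<in> Obj \<Omega>" if "v \<in> Obj \<Sigma>" for v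
  proof -
    obtain f where f: "f \<in> Mor \<Omega>" "v = \<phi> f"
      using ex \<open>v \<in> Obj \<Sigma>\<close> target_covering.source.source.Obj_subset by blast
    \<comment> \<open>An object is a morphism equal to its own source, a property that an injective
      functor reflects.\<close>
    then have "\<phi> (src \<Omega> f) = \<phi> f"
      using map_src[of f] target_covering.source.source.src_id that by simp
    then have "src \<Omega> f = f"
      using \<psi>\<phi>[OF f(1)] \<psi>\<phi>[OF src_Mor[OF f(1)]] by simp
    then show ?thesis
      using \<psi>\<phi>[OF f(1)] f source_covering.source.source.src_Obj[OF f(1)] by simp
  qed
  have "covering_morphism k \<Lambda> \<Sigma> q \<Omega> p \<psi>"
  proof unfold_locales
    fix b assume "b \<in> Mor \<Sigma>"
    then obtain f where f: "f \<in> Mor \<Omega>" "b = \<phi> f" using ex by blast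
    show "\<psi> b \<in> Mor \<Omega>" "src \<Omega> (\<psi> b) = \<psi> (src \<Sigma> b)" "rng \<Omega> (\<psi> b) = \<psi> (rng \<Sigma> b)"
      "deg \<Omega> (\<psi> b) = deg \<Sigma> b" "p (\<psi> b) = q b"
      using f src_Mor rng_Mor by (simp_all add: \<psi>\<phi> map_src map_rng map_deg over)
  next
    fix a b assume "a \<in> Mor \<Sigma>" "b \<in> Mor \<Sigma>" and ab: "src \<Sigma> a = rng \<Sigma> b"
    then obtain f g where fg: "f \<in> Mor \<Omega>" "a = \<phi> f" "g \<in> Mor \<Omega>" "b = \<phi> g"
      using ex by blast
    \<comment> \<open>Injectivity also reflects composability, so the preimages can be composed in
      \<open>\<Omega>\<close>.\<close>
    have "\<phi> (src \<Omega> f) = \<phi> (rng \<Omega> g)"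
      using ab fg by (simp add: map_src map_rng)
    then have "src \<Omega> f = rng \<Omega> g"
      using \<psi>\<phi>[OF src_Mor[OF fg(1)]] \<psi>\<phi>[OF rng_Mor[OF fg(3)]] by metis
    then show "\<psi> (a \<cdot>\<^bsub>\<Sigma>\<^esub> b) = \<psi> a \<cdot>\<^bsub>\<Omega>\<^esub> \<psi> b"
      using fg \<psi>\<phi> source_covering.source.source.cmp_closed by (simp flip: map_cmp)
  qed (rule \<psi>_Obj)
  moreover have "covering_morphism k \<Lambda> \<Omega> p \<Sigma> q \<phi>" by unfold_locales
  ultimately show ?thesis
    unfolding isomorphic_coverings_def using \<psi>\<phi>
    by (intro exI[of _ \<phi>] exI[of _ \<psi>]) (auto dest: ex)
qed

section \<open>The symmetric group and its point stabilisers\<close>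

lemma BijGroup_simps:
  "carrier (BijGroup F) = Bij F"
  "\<lbrakk>f \<in> Bij F; g \<in> Bij F\<rbrakk> \<Longrightarrow> f \<otimes>\<^bsub>BijGroup F\<^esub> g = compose F f g"
  "\<one>\<^bsub>BijGroup F\<^esub> = (\<lambda>x\<in>F. x)"
  by (simp_all add: BijGroup_def)

lemma Bij_apply: "\<lbrakk>f \<in> Bij F; x \<in> F\<rbrakk> \<Longrightarrow> f x \<in> F"
  using Bij_imp_funcset by (blast dest: funcset_mem)

text \<open>For \<open>y = x\<close> this is the stabiliser of \<open>x\<close>; for other
  \<open>y\<close> in \<open>F\<close> it is the left coset of the stabiliser that corresponds to
  \<open>y\<close>. One family thus describes both the subgroup and its cosets.\<close>

definition bijections_mapping :: "'a set \<Rightarrow> 'a \<Rightarrow> 'a \<Rightarrow> ('a \<Rightarrow> 'a) set"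
  where "bijections_mapping F x y = {g \<in> Bij F. g x = y}"

lemma bijections_mapping_nonempty:
  assumes "x \<in> F" "y \<in> F"
  shows "bijections_mapping F x y \<noteq> {}"
proof -
  \<comment> \<open>The transposition of \<open>x\<close> and \<open>y\<close> is its own inverse.
    It is restricted to \<open>F\<close> below because elements of \<open>Bij F\<close> are
    extensional.\<close>
  let ?t = "\<lambda>z. if z = x then y else if z = y then x else z"
  have "bij_betw ?t F F"
    using assms by (intro bij_betw_byWitness[where f' = ?t]) auto
  then have "restrict ?t F \<in> bijections_mapping F x y"
    using assms by (simp add: bijections_mapping_def Bij_def)
  then show ?thesis by blast
qed

lemma l_coset_bijections_mapping:
  assumes g: "g \<in> Bij F" and F: "x \<in> F" "y \<in> F"
  shows "g <#\<^bsub>BijGroup F\<^esub> bijections_mapping F x y = bijections_mapping F x (g y)"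
proof -
  interpret group "BijGroup F" by (rule group_BijGroup)
  \<comment> \<open>Used for \<open>g\<close> in one inclusion and for its inverse in the
    other.\<close>
  have *: "f \<otimes>\<^bsub>BijGroup F\<^esub> h \<in> bijections_mapping F x (f z)"
    if "f \<in> Bij F" "h \<in> bijections_mapping F x z" for f h z
    using that F m_closed[of f h]
    by (auto simp: bijections_mapping_def BijGroup_simps compose_eq)
  show ?thesis
  proof (intro equalityI subsetI)
    fix h assume "h \<in> g <#\<^bsub>BijGroup F\<^esub> bijections_mapping F x y"
    then show "h \<in> bijections_mapping F x (g y)"
      using * g by (auto simp: l_coset_def)
  next
    fix h assume h: "h \<in> bijections_mapping F x (g y)"
    let ?i = "inv\<^bsub>BijGroup F\<^esub> g"
    have i: "?i \<in> Bij F" using inv_closed[of g] g by (simp add: BijGroup_simps)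
    have "compose F ?i g = (\<lambda>x\<in>F. x)"
      using l_inv[of g] g i by (simp add: BijGroup_simps)
    then have "?i (g y) = y"
      using F by (metis compose_eq restrict_apply')
    then have "?i \<otimes>\<^bsub>BijGroup F\<^esub> h \<in> bijections_mapping F x y"
      using *[OF i h] by simp
    moreover have "h = g \<otimes>\<^bsub>BijGroup F\<^esub> (?i \<otimes>\<^bsub>BijGroup F\<^esub> h)"
      using g h i by (simp add: inv_solve_left bijections_mapping_def BijGroup_simps(1)
          flip: m_assoc)
    ultimately show "h \<in> g <#\<^bsub>BijGroup F\<^esub> bijections_mapping F x y"
      by (auto simp: l_coset_def)
  qed
qed

text \<open>An element \<open>g\<close> of the stabiliser \<open>H\<close> satisfies
  \<open>g x = x\<close>, so the previous lemma gives \<open>gH = H\<close>. Closure under products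
  is then immediate, and closure under inverses follows by cancelling \<open>g\<close> to get
  \<open>g^-1 H = H\<close> and using that the identity lies in \<open>H\<close>.\<close>

lemma subgroup_stabiliser:
  assumes "x \<in> F"
  shows "subgroup (bijections_mapping F x x) (BijGroup F)"
proof -
  interpret group "BijGroup F" by (rule group_BijGroup)
  have coset: "g <#\<^bsub>BijGroup F\<^esub> bijections_mapping F x x = bijections_mapping F x x"
    if "g \<in> bijections_mapping F x x" for g
    using that l_coset_bijections_mapping[of g F x x] assms by (auto simp: bijections_mapping_def)
  have sub: "bijections_mapping F x x \<subseteq> carrier (BijGroup F)"
    by (auto simp: bijections_mapping_def BijGroup_simps)
  show ?thesis
  proof (rule subgroupI)
    fix g assume g: "g \<in> bijections_mapping F x x"
    have "inv\<^bsub>BijGroup F\<^esub> g <#\<^bsub>BijGroup F\<^esub> bijections_mapping F x x = bijections_mapping F x x"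
      using l_coset_inv_cancel(1)[OF sub, of g] coset[OF g] g sub by auto
    moreover have "\<one>\<^bsub>BijGroup F\<^esub> \<in> bijections_mapping F x x"
      using assms one_closed by (auto simp: bijections_mapping_def BijGroup_simps)
    ultimately show "inv\<^bsub>BijGroup F\<^esub> g \<in> bijections_mapping F x x"
      using g sub r_one inv_closed by (force simp: l_coset_def)
  next
    fix g h assume "g \<in> bijections_mapping F x x" "h \<in> bijections_mapping F x x"
    then show "g \<otimes>\<^bsub>BijGroup F\<^esub> h \<in> bijections_mapping F x x"
      using coset by (fastforce simp: l_coset_def)
  qed (use sub bijections_mapping_nonempty[OF assms assms] in auto)
qed

text \<open>Orbit-stabiliser correspondence: the coset of \<open>g\<close> is the set of
  permutations taking \<open>x\<close> to \<open>g x\<close>, and by transitivity the points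
  \<open>g x\<close> exhaust \<open>F\<close>. A nonempty coset determines its point, which gives
  injectivity.\<close>

lemma bij_betw_lcosets_stabiliser:
  assumes x: "x \<in> F"
  shows "bij_betw (bijections_mapping F x) F (lcosets\<^bsub>BijGroup F\<^esub> bijections_mapping F x x)"
  unfolding bij_betw_def
proof
  show "inj_on (bijections_mapping F x) F"
  proof (rule inj_onI)
    fix y z assume "y \<in> F" "z \<in> F" "bijections_mapping F x y = bijections_mapping F x z"
    then show "y = z"
      using bijections_mapping_nonempty[OF x \<open>y \<in> F\<close>] by (auto simp: bijections_mapping_def)
  qed
  have "bijections_mapping F x ` F = (\<lambda>g. bijections_mapping F x (g x)) ` Bij F"
  proof (intro equalityI subsetI)
    fix C assume "C \<in> bijections_mapping F x ` F"
    then obtain y where y: "y \<in> F" "C = bijections_mapping F x y" by blast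
    then obtain g where "g \<in> Bij F" "g x = y"
      using bijections_mapping_nonempty[OF x y(1)] by (auto simp: bijections_mapping_def)
    then show "C \<in> (\<lambda>g. bijections_mapping F x (g x)) ` Bij F" using y by blast
  qed (auto intro: Bij_apply[OF _ x])
  then show "bijections_mapping F x ` F = lcosets\<^bsub>BijGroup F\<^esub> bijections_mapping F x x"
    using x by (auto simp: LCOSETS_def BijGroup_simps l_coset_bijections_mapping)
qed

section \<open>Fibres of a covering\<close>

lemma bij_betw_Ex1: "bij_betw f A B \<Longrightarrow> y \<in> B \<Longrightarrow> \<exists>!x. x \<in> A \<and> f x = y"
  by (auto simp: bij_betw_def inj_on_def)

context covering
begin

definition fibre :: "'a \<Rightarrow> 'b set"
  where "fibre v = {w \<in> Obj \<Omega>. p w = v}"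

definition lifts :: "'a \<Rightarrow> 'b set"
  where "lifts \<kappa> = {f \<in> Mor \<Omega>. p f = \<kappa>}"

text \<open>Unique lifting: at a vertex \<open>w\<close> over the source of \<open>\<kappa>\<close>,
  the covering bijection on \<open>out_of \<Omega> w\<close> provides exactly one lift of
  \<open>\<kappa>\<close> starting there. With its counterpart for ranges,
  \<open>lifts \<kappa>\<close> links the two end fibres.\<close>

lemma bij_betw_src_lifts:
  assumes "\<kappa> \<in> Mor \<Lambda>"
  shows "bij_betw (src \<Omega>) (lifts \<kappa>) (fibre (src \<Lambda> \<kappa>))"
proof -
  have "\<exists>!f. f \<in> lifts \<kappa> \<and> src \<Omega> f = w" if w: "w \<in> fibre (src \<Lambda> \<kappa>)" for w
    using bij_betw_Ex1[OF bij_out_of[of w], of \<kappa>] w assms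
    by (simp add: fibre_def lifts_def out_of_def conj_ac)
  moreover have "src \<Omega> f \<in> fibre (src \<Lambda> \<kappa>)" if "f \<in> lifts \<kappa>" for f
    using that by (auto simp: fibre_def lifts_def map_src source.source.src_Obj)
  ultimately show ?thesis
    unfolding bij_betw_def inj_on_def by blast
qed

lemma bij_betw_rng_lifts:
  assumes "\<kappa> \<in> Mor \<Lambda>"
  shows "bij_betw (rng \<Omega>) (lifts \<kappa>) (fibre (rng \<Lambda> \<kappa>))"
proof -
  have "\<exists>!f. f \<in> lifts \<kappa> \<and> rng \<Omega> f = w" if w: "w \<in> fibre (rng \<Lambda> \<kappa>)" for w
    using bij_betw_Ex1[OF bij_into[of w], of \<kappa>] w assms
    by (simp add: fibre_def lifts_def into_def conj_ac)
  moreover have "rng \<Omega> f \<in> fibre (rng \<Lambda> \<kappa>)" if "f \<in> lifts \<kappa>" for f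
    using that by (auto simp: fibre_def lifts_def map_rng source.source.rng_Obj)
  ultimately show ?thesis
    unfolding bij_betw_def inj_on_def by blast
qed

text \<open>Surjectivity is known on morphisms, and a lift of a vertex \<open>v\<close> might not
  obviously be a vertex; its source is one, and lies over the source of \<open>v\<close>, which is
  \<open>v\<close>.\<close>

lemma Obj_image: "p ` Obj \<Omega> = Obj \<Lambda>"
proof
  show "Obj \<Lambda> \<subseteq> p ` Obj \<Omega>"
  proof
    fix v assume v: "v \<in> Obj \<Lambda>"
    then obtain f where "f \<in> Mor \<Omega>" "p f = v"
      using surjective target.source.Obj_subset by (metis imageE subsetD)
    then show "v \<in> p ` Obj \<Omega>"
      using v map_src[of f] target.source.src_id source.source.src_Obj by (metis imageI)
  qed
qed (use map_Obj in auto)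

end

text \<open>Having equipollent fibres is an equivalence relation, and it contains the generating
  pairs because the lifts of the image of a connecting morphism biject with both end fibres. By
  connectedness it relates all vertices.\<close>

lemma (in connected_covering) fibre_eqpoll:
  assumes "u \<in> Obj \<Omega>" "v \<in> Obj \<Omega>"
  shows "fibre (p u) \<approx> fibre (p v)"
proof -
  let ?E = "{(u, v). u \<in> Obj \<Omega> \<and> v \<in> Obj \<Omega> \<and> fibre (p u) \<approx> fibre (p v)}"
  let ?R = "{(u, v). u \<in> Obj \<Omega> \<and> v \<in> Obj \<Omega> \<and> hom_set \<Omega> u v \<noteq> {}}"
  have "equiv (Obj \<Omega>) ?E"
    by (auto intro!: equivI refl_onI symI transI intro: eqpoll_sym eqpoll_trans)
  moreover have "?R \<subseteq> ?E"
  proof clarify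
    fix u v assume uv: "u \<in> Obj \<Omega>" "v \<in> Obj \<Omega>" and "hom_set \<Omega> u v \<noteq> {}"
    then obtain f where f: "f \<in> Mor \<Omega>" "rng \<Omega> f = u" "src \<Omega> f = v"
      by (auto simp: hom_set_def into_def out_of_def)
    have "lifts (p f) \<approx> fibre (p u)" "lifts (p f) \<approx> fibre (p v)"
      using bij_betw_rng_lifts[of "p f"] bij_betw_src_lifts[of "p f"] f
      by (auto simp: eqpoll_def map_Mor map_src map_rng)
    then show "fibre (p u) \<approx> fibre (p v)"
      using eqpoll_sym eqpoll_trans by blast
  qed
  ultimately have "generated_equiv (Obj \<Omega>) ?R \<subseteq> ?E"
    unfolding generated_equiv_def by blast
  then show ?thesis
    using connected assms by (auto simp: connected_category_def)
qed

text \<open>If \<open>\<Omega>\<close> is empty, so is \<open>\<Lambda>\<close>, and any nonempty \<open>F\<close> will do.\<close>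

lemma (in connected_covering) obtain_trivialisation:
  obtains F :: "'b set" and c
  where "F \<noteq> {}" "\<And>v. v \<in> Obj \<Lambda> \<Longrightarrow> bij_betw c (fibre v) F"
proof (cases "Obj \<Omega> = {}")
  case True
  then show ?thesis using that[of UNIV] Obj_image by auto
next
  case False
  then obtain w where w: "w \<in> Obj \<Omega>" by blast
  then have "\<forall>v\<in>Obj \<Lambda>. \<exists>b. bij_betw b (fibre v) (fibre (p w))"
    using fibre_eqpoll w unfolding eqpoll_def Obj_image[symmetric] by blast
  then obtain b where b: "\<And>v. v \<in> Obj \<Lambda> \<Longrightarrow> bij_betw (b v) (fibre v) (fibre (p w))"
    by metis
  \<comment> \<open>The bijections chosen fibre by fibre are glued into one function;
    \<open>p u\<close> tells which of them applies to \<open>u\<close>.\<close>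
  have "bij_betw (\<lambda>u. b (p u) u) (fibre v) (fibre (p w))" if "v \<in> Obj \<Lambda>" for v
    using b[OF that] by (subst bij_betw_cong[of _ _ "b v"]) (auto simp: fibre_def)
  moreover have "fibre (p w) \<noteq> {}" using w by (auto simp: fibre_def)
  ultimately show ?thesis using that by blast
qed

section \<open>The transport cocycle\<close>

locale trivialised_covering = covering k \<Lambda> \<Omega> p
  for k :: nat
    and \<Lambda> :: "('a, 'n) kgraph_scheme" (structure)
    and \<Omega> :: "('b, 'm) kgraph_scheme" (structure)
    and p :: "'b \<Rightarrow> 'a" +
  fixes F :: "'c set" and c :: "'b \<Rightarrow> 'c"
  assumes bij_betw_fibre: "v \<in> Obj \<Lambda> \<Longrightarrow> bij_betw c (fibre v) F"
begin

lemma bij_betw_src_label: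
  "\<kappa> \<in> Mor \<Lambda> \<Longrightarrow> bij_betw (c \<circ> src \<Omega>) (lifts \<kappa>) F"
  by (rule bij_betw_trans[OF bij_betw_src_lifts bij_betw_fibre]) (auto simp: target.source.src_Obj)

lemma bij_betw_rng_label:
  "\<kappa> \<in> Mor \<Lambda> \<Longrightarrow> bij_betw (c \<circ> rng \<Omega>) (lifts \<kappa>) F"
  by (rule bij_betw_trans[OF bij_betw_rng_lifts bij_betw_fibre]) (auto simp: target.source.rng_Obj)

text \<open>Start at the vertex over the source of \<open>\<kappa>\<close> with label
  \<open>x\<close>, follow the lift of \<open>\<kappa>\<close> from there, and read the label at its
  end. Restricting to \<open>F\<close> makes the result extensional, as \<open>Bij F\<close>
  demands.\<close>

definition transport :: "'a \<Rightarrow> 'c \<Rightarrow> 'c"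
  where "transport \<kappa> = (\<lambda>x\<in>F. c (rng \<Omega> (inv_into (lifts \<kappa>) (c \<circ> src \<Omega>) x)))"

lemma label_in: "w \<in> Obj \<Omega> \<Longrightarrow> c w \<in> F"
  using bij_betw_fibre[of "p w"] map_Obj[of w] by (auto simp: fibre_def bij_betw_def)

lemma transport_Bij:
  assumes "\<kappa> \<in> Mor \<Lambda>"
  shows "transport \<kappa> \<in> Bij F"
proof -
  have "bij_betw ((c \<circ> rng \<Omega>) \<circ> inv_into (lifts \<kappa>) (c \<circ> src \<Omega>)) F F"
    by (rule bij_betw_trans[OF bij_betw_inv_into[OF bij_betw_src_label[OF assms]]
          bij_betw_rng_label[OF assms]])
  then have "bij_betw (transport \<kappa>) F F"
    by (rule bij_betw_cong[THEN iffD1, rotated]) (simp add: transport_def)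
  then show ?thesis by (simp add: Bij_def transport_def)
qed

lemma transport_label:
  assumes "f \<in> Mor \<Omega>"
  shows "transport (p f) (c (src \<Omega> f)) = c (rng \<Omega> f)"
  using bij_betw_inv_into_left[OF bij_betw_src_label[of "p f"], of f] assms
  by (simp add: transport_def label_in source.source.src_Obj map_Mor lifts_def)

lemma obtain_lift:
  assumes "\<kappa> \<in> Mor \<Lambda>" "x \<in> F"
  obtains f where "f \<in> Mor \<Omega>" "p f = \<kappa>" "c (src \<Omega> f) = x"
  using bij_betw_Ex1[OF bij_betw_src_label[OF assms(1)] assms(2)] by (auto simp: lifts_def)

lemma label_inj: "\<lbrakk>u \<in> Obj \<Omega>; w \<in> Obj \<Omega>; p u = p w; c u = c w\<rbrakk> \<Longrightarrow> u = w"
  using bij_betw_fibre[of "p w"] map_Obj[of w] by (auto simp: bij_betw_def inj_on_def fibre_def)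

text \<open>Functoriality is uniqueness of lifts: lifts of two composable morphisms that meet
  compose to a lift of the composite, and the lift of a vertex is a vertex.\<close>

lemma cocycle_transport: "cocycle k \<Lambda> (BijGroup F) transport"
proof -
  interpret B: group "BijGroup F" by (rule group_BijGroup)
  interpret M: small_category "monoid_category (BijGroup F)"
    by (rule B.small_category_monoid_category)
  have cmp: "transport (\<kappa> \<cdot>\<^bsub>\<Lambda>\<^esub> \<mu>) = compose F (transport \<kappa>) (transport \<mu>)"
    if \<kappa>\<mu>: "\<kappa> \<in> Mor \<Lambda>" "\<mu> \<in> Mor \<Lambda>" "src \<Lambda> \<kappa> = rng \<Lambda> \<mu>" for \<kappa> \<mu>
  proof
    fix x
    show "transport (\<kappa> \<cdot>\<^bsub>\<Lambda>\<^esub> \<mu>) x = compose F (transport \<kappa>) (transport \<mu>) x"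
    proof (cases "x \<in> F")
      case True
      obtain g where g: "g \<in> Mor \<Omega>" "p g = \<mu>" "c (src \<Omega> g) = x"
        using obtain_lift \<kappa>\<mu>(2) True .
      \<comment> \<open>The lift of \<open>\<kappa>\<close> is chosen to start at the label where
        \<open>g\<close> ends. Both vertices lie over \<open>src \<Lambda> \<kappa>\<close>, so
        equal labels make them equal and \<open>f\<close>, \<open>g\<close> composable.\<close>
      obtain f where f: "f \<in> Mor \<Omega>" "p f = \<kappa>" "c (src \<Omega> f) = c (rng \<Omega> g)"
        using obtain_lift[OF \<kappa>\<mu>(1)] label_in[OF source.source.rng_Obj[OF g(1)]] .
      have eq: "src \<Omega> f = rng \<Omega> g"
        using f g \<kappa>\<mu>(3) map_src[of f] map_rng[of g]
        by (intro label_inj source.source.src_Obj source.source.rng_Obj) auto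
      then have "transport (p (f \<cdot>\<^bsub>\<Omega>\<^esub> g)) (c (src \<Omega> (f \<cdot>\<^bsub>\<Omega>\<^esub> g))) = c (rng \<Omega> (f \<cdot>\<^bsub>\<Omega>\<^esub> g))"
        using f g by (intro transport_label source.source.cmp_closed)
      then have "transport (\<kappa> \<cdot>\<^bsub>\<Lambda>\<^esub> \<mu>) x = c (rng \<Omega> f)"
        using f g eq by (simp add: map_cmp source.source.src_cmp source.source.rng_cmp)
      also have "\<dots> = transport \<kappa> (transport \<mu> x)"
        using f g transport_label[of f] transport_label[of g] by simp
      finally show ?thesis using True by (simp add: compose_eq)
    qed (simp add: compose_def transport_def)
  qed
  have Obj: "transport v = (\<lambda>x\<in>F. x)" if v: "v \<in> Obj \<Lambda>" for v
  proof
    fix x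
    show "transport v x = (\<lambda>x\<in>F. x) x"
    proof (cases "x \<in> F")
      case True
      then obtain w where w: "w \<in> Obj \<Omega>" "p w = v" "c w = x"
        using bij_betw_Ex1[OF bij_betw_fibre[OF v] True] by (auto simp: fibre_def)
      then show ?thesis
        using transport_label[of w] source.source.Obj_subset True
        by (auto simp: source.source.src_id source.source.rng_id)
    qed (simp add: transport_def)
  qed
  have "category_functor \<Lambda> (monoid_category (BijGroup F)) transport"
    by unfold_locales
      (auto simp: BijGroup_simps transport_Bij Obj cmp target.source.src_Obj target.source.rng_Obj)
  then show ?thesis
    by (intro cocycle.intro target.k_graph_axioms B.group_axioms)
qed

text \<open>A morphism of \<open>\<Omega>\<close> is determined by its image and the label of its
  source; the orbit-stabiliser bijection \<open>?b\<close> turns labels into cosets.\<close>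

lemma isomorphic_relative_skew_product:
  assumes x: "x \<in> F"
  shows "isomorphic_coverings k \<Lambda> \<Omega> p
    (relative_skew_product \<Lambda> (BijGroup F) transport (bijections_mapping F x x)) fst"
proof -
  let ?H = "bijections_mapping F x x"
  let ?S = "relative_skew_product \<Lambda> (BijGroup F) transport ?H"
  let ?b = "bijections_mapping F x"
  let ?\<phi> = "\<lambda>f. (p f, ?b (c (src \<Omega> f)))"
  interpret S: covering k \<Lambda> ?S fst
    by (rule cocycle.covering_relative_skew_product[OF cocycle_transport subgroup_stabiliser[OF x]])
  note bij = bij_betw_lcosets_stabiliser[OF x]
  have b: "?b (c w) \<in> lcosets\<^bsub>BijGroup F\<^esub> ?H" if "w \<in> Obj \<Omega>" for w
    using bij label_in[OF that] by (auto simp: bij_betw_def)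
  have src_idem: "src \<Omega> (src \<Omega> f) = src \<Omega> f" "src \<Omega> (rng \<Omega> f) = rng \<Omega> f" if "f \<in> Mor \<Omega>" for f
    using that by (simp_all add: source.source.src_id source.source.src_Obj source.source.rng_Obj)
  \<comment> \<open>Ranges are the decisive point: translating
    \<open>?b (c (src \<Omega> f))\<close> by \<open>transport (p f)\<close> gives
    \<open>?b (c (rng \<Omega> f))\<close>, by \<open>l_coset_bijections_mapping\<close> and
    \<open>transport_label\<close>.\<close>
  interpret \<phi>: covering_morphism k \<Lambda> \<Omega> p ?S fst ?\<phi>
    by unfold_locales
      (auto simp: b map_Mor map_Obj map_src map_rng map_cmp map_deg
        source.source.src_Obj source.source.rng_Obj source.source.src_id source.source.src_cmp
        src_idem l_coset_bijections_mapping transport_Bij x label_in transport_label)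
  have "inj_on ?\<phi> (Mor \<Omega>)"
  proof (rule inj_onI)
    fix f g assume f: "f \<in> Mor \<Omega>" and g: "g \<in> Mor \<Omega>" and "?\<phi> f = ?\<phi> g"
    then have "p f = p g" "c (src \<Omega> f) = c (src \<Omega> g)"
      using bij label_in source.source.src_Obj by (auto simp: bij_betw_def inj_on_def)
    then show "f = g"
      using bij_betw_src_label[of "p g"] map_Mor f g
      by (auto simp: bij_betw_def inj_on_def lifts_def)
  qed
  moreover have "Mor ?S \<subseteq> ?\<phi> ` Mor \<Omega>"
  proof clarsimp
    fix \<kappa> X assume \<kappa>: "\<kappa> \<in> Mor \<Lambda>" and "X \<in> lcosets\<^bsub>BijGroup F\<^esub> ?H"
    then obtain y where y: "y \<in> F" "X = ?b y"
      using bij by (auto simp: bij_betw_def)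
    obtain f where "f \<in> Mor \<Omega>" "p f = \<kappa>" "c (src \<Omega> f) = y"
      using obtain_lift \<kappa> y(1) .
    then show "(\<kappa>, X) \<in> ?\<phi> ` Mor \<Omega>" using y by blast
  qed
  ultimately show ?thesis
    using \<phi>.map_Mor by (intro \<phi>.isomorphic_coverings_if_bij) (auto simp: bij_betw_def)
qed

end

theorem corollary6p10:
  fixes k :: nat
    and \<Lambda> :: "'a kgraph"
    and \<Omega> :: "'b kgraph"
    and p :: "'b \<Rightarrow> 'a"
  assumes "connected_covering k \<Lambda> \<Omega> p"
  shows "\<exists>(G :: ('b \<Rightarrow> 'b) monoid) \<eta> H.
    group G \<and> cocycle k \<Lambda> G \<eta> \<and> subgroup H G \<and>
    isomorphic_coverings k \<Lambda> \<Omega> p (relative_skew_product \<Lambda> G \<eta> H) fst"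
proof -
  interpret connected_covering k \<Lambda> \<Omega> p by (rule assms)
  \<comment> \<open>Labels are taken in the type of \<open>\<Omega>\<close> itself, so the symmetric
    group of \<open>F\<close> has elements of type \<open>'b \<Rightarrow> 'b\<close>. Nonemptiness
    of \<open>F\<close> supplies the point whose stabiliser serves as \<open>H\<close>.\<close>
  obtain F :: "'b set" and c where "F \<noteq> {}"
    and c: "\<And>v. v \<in> Obj \<Lambda> \<Longrightarrow> bij_betw c (fibre v) F"
    using obtain_trivialisation by blast
  then obtain x where x: "x \<in> F" by blast
  interpret trivialised_covering k \<Lambda> \<Omega> p F c
    by unfold_locales (rule c)
  show ?thesis
    using group_BijGroup cocycle_transport subgroup_stabiliser[OF x]
      isomorphic_relative_skew_product[OF x] by blast
qed

end
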